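(* Let $\mathbb{X}$ be a separable reflexive Banach space whose dual $\mathbb{X}^*$ is strictly convex, $J=[0,T]$, and let $\{\mathrm{A}(t):t\in J\}$ be a family of linear operators on $\mathbb{X}$ satisfying (R1)-(R4) listed in the context, with associated evolution family $\{\mathrm{U}(t,s):0\le s\le t\le T\}$. Define $\mathrm{G}:\mathrm{L}^1(J;\mathbb{X})\to\mathrm{PC}(J;\mathbb{X})$ by $(\mathrm{G}h)(t):=\int_0^t\mathrm{U}(t,s)h(s)\,\mathrm{d}s$, $t\in J$. If $\{h_n\}_{n\ge1}\subset\mathrm{L}^1(J;\mathbb{X})$ is any integrably bounded sequence such that $h_n\to h$ weakly in $\mathrm{L}^1(J;\mathbb{X})$ as $n\to\infty$, then $$\mathrm{G}(h_n)\to\mathrm{G}(h)\ \text{ in }\ \mathrm{PC}(J;\mathbb{X})\ \text{ as }\ n\to\infty.$$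
   Context: $\mathrm{PC}(J;\mathbb{X})$, for fixed points $0<\tau_1<\dots<\tau_m<T$, is the space of functions $x:J\to\mathbb{X}$ continuous on $J\setminus\{\tau_1,\dots,\tau_m\}$ with $x(\tau_k^-)=x(\tau_k)$ and such that $x(\tau_k^+)$ exists for $k=1,\dots,m$, with norm $\|x\|_{\mathrm{PC}}=\sup_{s\in J}\|x(s)\|_{\mathbb{X}}$. A sequence $\{h_n\}\subset\mathrm{L}^1(J;\mathbb{X})$ is integrably bounded if there is $\sigma\in\mathrm{L}^1(J;[0,+\infty))$ with $\|h_n(t)\|_{\mathbb{X}}\le\sigma(t)$ for a.e. $t\in J$ and all $n$. Conditions ($\mathrm{R}(\lambda,\mathrm{A}(t))$ is the resolvent, $\rho(\mathrm{A}(t))$ the resolvent set): (R1) For each $t\in J$ the linear operator $\mathrm{A}(t)$ is closed, and its domain $\mathrm{D}(\mathrm{A}(t))=\mathrm{D}(\mathrm{A})$ is dense in $\mathbb{X}$ and independent of $t$. (R2) For $t\in J$, $\mathrm{R}(\lambda,\mathrm{A}(t))$ exists for all $\lambda$ with $\mathrm{Re}\,\lambda\ge0$, and there is $K>0$ with $\|\mathrm{R}(\lambda,\mathrm{A}(t))\|_{\mathcal{L}(\mathbb{X})}\le\frac{K}{|\lambda|+1}$. (R3) There are constants $N>0$ and $0<\delta\le1$ such that $\|(\mathrm{A}(t)-\mathrm{A}(s))\mathrm{A}^{-1}(\tau)\|_{\mathcal{L}(\mathbb{X})}\le N|t-s|^\delta$ for all $t,s,\tau\in J$. (R4) For $t\in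 J$, $\mathrm{R}(\lambda,\mathrm{A}(t))$ is compact for some $\lambda\in\rho(\mathrm{A}(t))$. An evolution family is a family of bounded linear operators $\{\mathrm{U}(t,s):0\le s\le t\le T\}$ with $\mathrm{U}(s,s)=\mathrm{I}$, $\mathrm{U}(t,r)\mathrm{U}(r,s)=\mathrm{U}(t,s)$ for $0\le s\le r\le t\le T$, and $(t,s)\mapsto\mathrm{U}(t,s)$ strongly continuous. Under (R1)-(R3), $\mathrm{U}(t,s)$ denotes the unique evolution family generated by $\{\mathrm{A}(t)\}$ (Pazy, Chapter 5, Theorem 6.1): $\|\mathrm{U}(t,s)\|_{\mathcal{L}(\mathbb{X})}\le C$ for some $C\ge1$; for $s<t$, $\mathrm{U}(t,s)$ maps $\mathbb{X}$ into $\mathrm{D}(\mathrm{A})$, $\frac{\partial}{\partial t}\mathrm{U}(t,s)=\mathrm{A}(t)\mathrm{U}(t,s)$ (strongly) with $\|\mathrm{A}(t)\mathrm{U}(t,s)\|_{\mathcal{L}(\mathbb{X})}\le\frac{C}{t-s}$; $\|\mathrm{A}(t)\mathrm{U}(t,s)\mathrm{A}(s)^{-1}\|_{\mathcal{L}(\mathbb{X})}\le C$; and $\frac{\partial}{\partial s}\mathrm{U}(t,s)v=-\mathrm{U}(t,s)\mathrm{A}(s)v$ for $v\in\mathrm{D}(\mathrm{A})$. Under (R1)-(R4), $\mathrm{U}(t,s)$ is a compact operator whenever $t-s>0$ (known result). *)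

theory Defs
  imports "HOL-Analysis.Analysis"
begin

section \<open>Complex normed spaces\<close>

text \<open>The spectral conditions below involve complex \<open>\<lambda>\<close>, so the scalar field is complex.  The class
  extends \<^class>\<open>real_normed_vector\<close>; the real structure is the restriction of the complex one, so
  that the topology, the Bochner integral and derivatives of the library apply unchanged.\<close>

class complex_normed_vector = real_normed_vector +
  fixes scaleC :: "complex \<Rightarrow> 'a \<Rightarrow> 'a"  (infixr \<open>*\<^sub>C\<close> 75)
  assumes scaleC_add_right: "a *\<^sub>C (x + y) = a *\<^sub>C x + a *\<^sub>C y"
    and scaleC_add_left: "(a + b) *\<^sub>C x = a *\<^sub>C x + b *\<^sub>C x"
    and scaleC_scaleC: "a *\<^sub>C b *\<^sub>C x = (a * b) *\<^sub>C x"
    and scaleC_one: "1 *\<^sub>C x = x"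
    and scaleR_scaleC: "r *\<^sub>R x = complex_of_real r *\<^sub>C x"
    and norm_scaleC: "norm (a *\<^sub>C x) = cmod a * norm x"

instantiation complex :: complex_normed_vector
begin
definition scaleC_complex :: "complex \<Rightarrow> complex \<Rightarrow> complex"
  where "scaleC_complex a x = a * x"
instance
  by standard (simp_all add: scaleC_complex_def algebra_simps norm_mult scaleR_conv_of_real)
end

section \<open>The dual space, reflexivity and strict convexity\<close>

text \<open>The (complex) dual, as a subspace of the real-linear bounded maps into the complex numbers;
  the norm of \<^typ>\<open>'a \<Rightarrow>\<^sub>L complex\<close> restricts to the usual dual norm.\<close>

definition complex_dual :: "('a::complex_normed_vector \<Rightarrow>\<^sub>L complex) set"
  where "complex_dual = {f. \<forall>c x. blinfun_apply f (c *\<^sub>C x) = c * blinfun_apply f x}"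

text \<open>Elements of the bidual are the bounded complex-linear functionals on \<^const>\<open>complex_dual\<close>;
  \<open>blinfun_mult_right c o\<^sub>L f\<close> is the functional \<open>x \<mapsto> c * f x\<close>.\<close>

definition complex_bidual :: "(('a::complex_normed_vector \<Rightarrow>\<^sub>L complex) \<Rightarrow> complex) set"
  where "complex_bidual = {\<Phi>.
    (\<forall>f\<in>complex_dual. \<forall>g\<in>complex_dual. \<Phi> (f + g) = \<Phi> f + \<Phi> g) \<and>
    (\<forall>c. \<forall>f\<in>complex_dual. \<Phi> (blinfun_mult_right c o\<^sub>L f) = c * \<Phi> f) \<and>
    (\<exists>M. \<forall>f\<in>complex_dual. cmod (\<Phi> f) \<le> M * norm f)}"

definition reflexive_space :: "'a::complex_normed_vector itself \<Rightarrow> bool"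
  where "reflexive_space _ \<longleftrightarrow>
    (\<forall>\<Phi>\<in>complex_bidual. \<exists>x::'a. \<forall>f\<in>complex_dual. \<Phi> f = blinfun_apply f x)"

definition strictly_convex_dual :: "'a::complex_normed_vector itself \<Rightarrow> bool"
  where "strictly_convex_dual _ \<longleftrightarrow>
    (\<forall>f\<in>complex_dual :: ('a \<Rightarrow>\<^sub>L complex) set. \<forall>g\<in>complex_dual. \<forall>t::real.
       norm f = 1 \<and> norm g = 1 \<and> f \<noteq> g \<and> 0 < t \<and> t < 1 \<longrightarrow>
       norm (t *\<^sub>R f + (1 - t) *\<^sub>R g) < 1)"

section \<open>Unbounded operators and their resolvents\<close>

text \<open>An unbounded operator is a domain \<open>D\<close> together with a map \<open>A\<close> whose values outside \<open>D\<close> are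
  irrelevant.\<close>

definition linear_operator :: "'a::complex_normed_vector set \<Rightarrow> ('a \<Rightarrow> 'a) \<Rightarrow> bool"
  where "linear_operator D A \<longleftrightarrow>
    0 \<in> D \<and>
    (\<forall>x\<in>D. \<forall>y\<in>D. x + y \<in> D \<and> A (x + y) = A x + A y) \<and>
    (\<forall>c. \<forall>x\<in>D. c *\<^sub>C x \<in> D \<and> A (c *\<^sub>C x) = c *\<^sub>C A x)"

definition closed_operator :: "'a::complex_normed_vector set \<Rightarrow> ('a \<Rightarrow> 'a) \<Rightarrow> bool"
  where "closed_operator D A \<longleftrightarrow> closed ((\<lambda>x. (x, A x)) ` D)"

definition resolvent :: "complex \<Rightarrow> 'a::complex_normed_vector set \<Rightarrow> ('a \<Rightarrow> 'a) \<Rightarrow> 'a \<Rightarrow> 'a"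
  where "resolvent l D A = inv_into D (\<lambda>x. l *\<^sub>C x - A x)"

definition resolvent_set :: "'a::complex_normed_vector set \<Rightarrow> ('a \<Rightarrow> 'a) \<Rightarrow> complex set"
  where "resolvent_set D A =
    {l. bij_betw (\<lambda>x. l *\<^sub>C x - A x) D UNIV \<and> bounded_linear (resolvent l D A)}"

text \<open>\<^const>\<open>onorm\<close> is a junk value for unbounded maps, hence the explicit boundedness.\<close>

definition opnorm_le :: "('a::real_normed_vector \<Rightarrow> 'a) \<Rightarrow> real \<Rightarrow> bool"
  where "opnorm_le F c \<longleftrightarrow> bounded_linear F \<and> onorm F \<le> c"

definition compact_operator :: "('a::real_normed_vector \<Rightarrow> 'a) \<Rightarrow> bool"
  where "compact_operator F \<longleftrightarrow> bounded_linear F \<and> compact (closure (F ` cball 0 1))"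

section \<open>Conditions on the family of operators\<close>

definition cond_R1 :: "real \<Rightarrow> (real \<Rightarrow> 'a::complex_normed_vector set) \<Rightarrow> (real \<Rightarrow> 'a \<Rightarrow> 'a) \<Rightarrow> bool"
  where "cond_R1 T D A \<longleftrightarrow>
    (\<forall>t\<in>{0..T}. linear_operator (D t) (A t) \<and> closed_operator (D t) (A t) \<and>
       closure (D t) = UNIV) \<and>
    (\<forall>t\<in>{0..T}. \<forall>s\<in>{0..T}. D t = D s)"

definition cond_R2 :: "real \<Rightarrow> (real \<Rightarrow> 'a::complex_normed_vector set) \<Rightarrow> (real \<Rightarrow> 'a \<Rightarrow> 'a) \<Rightarrow> bool"
  where "cond_R2 T D A \<longleftrightarrow>
    (\<exists>K>0. \<forall>t\<in>{0..T}. \<forall>l. Re l \<ge> 0 \<longrightarrow>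
       l \<in> resolvent_set (D t) (A t) \<and>
       opnorm_le (resolvent l (D t) (A t)) (K / (cmod l + 1)))"

text \<open>\<open>inv_into (D \<tau>) (A \<tau>)\<close> is the inverse of \<open>A(\<tau>)\<close>, a bijection from \<open>D \<tau>\<close> onto the whole space
  because \<open>0\<close> lies in the resolvent set.\<close>

definition cond_R3 :: "real \<Rightarrow> (real \<Rightarrow> 'a::complex_normed_vector set) \<Rightarrow> (real \<Rightarrow> 'a \<Rightarrow> 'a) \<Rightarrow> bool"
  where "cond_R3 T D A \<longleftrightarrow>
    (\<exists>N>0. \<exists>\<delta>>0. \<delta> \<le> 1 \<and>
      (\<forall>t\<in>{0..T}. \<forall>s\<in>{0..T}. \<forall>\<tau>\<in>{0..T}.
         opnorm_le (\<lambda>x. A t (inv_into (D \<tau>) (A \<tau>) x) - A s (inv_into (D \<tau>) (A \<tau>) x))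
           (N * \<bar>t - s\<bar> powr \<delta>)))"

definition cond_R4 :: "real \<Rightarrow> (real \<Rightarrow> 'a::complex_normed_vector set) \<Rightarrow> (real \<Rightarrow> 'a \<Rightarrow> 'a) \<Rightarrow> bool"
  where "cond_R4 T D A \<longleftrightarrow>
    (\<forall>t\<in>{0..T}. \<exists>l\<in>resolvent_set (D t) (A t). compact_operator (resolvent l (D t) (A t)))"

section \<open>Evolution families\<close>

text \<open>Only the values \<open>U t s\<close> with \<open>0 \<le> s \<le> t \<le> T\<close> matter.\<close>

definition evolution_family :: "real \<Rightarrow> (real \<Rightarrow> real \<Rightarrow> 'a::complex_normed_vector \<Rightarrow>\<^sub>L 'a) \<Rightarrow> bool"
  where "evolution_family T U \<longleftrightarrow>
    (\<forall>t s. 0 \<le> s \<and> s \<le> t \<and> t \<le> T \<longrightarrow> (\<forall>c x. U t s (c *\<^sub>C x) = c *\<^sub>C U t s x)) \<and>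
    (\<forall>s\<in>{0..T}. U s s = id_blinfun) \<and>
    (\<forall>t r s. 0 \<le> s \<and> s \<le> r \<and> r \<le> t \<and> t \<le> T \<longrightarrow> U t r o\<^sub>L U r s = U t s) \<and>
    (\<forall>x. continuous_on {(t, s). 0 \<le> s \<and> s \<le> t \<and> t \<le> T} (\<lambda>(t, s). U t s x))"

text \<open>The evolution family generated by \<open>A\<close> in the sense of Pazy's theorem for parabolic evolution
  equations; the two derivative conditions determine \<open>U\<close> uniquely.  At the boundary of the domain of
  \<open>U\<close> the derivatives are one-sided.\<close>

definition generates_evolution_family ::
  "real \<Rightarrow> (real \<Rightarrow> 'a::complex_normed_vector set) \<Rightarrow> (real \<Rightarrow> 'a \<Rightarrow> 'a) \<Rightarrow>
   (real \<Rightarrow> real \<Rightarrow> 'a \<Rightarrow>\<^sub>L 'a) \<Rightarrow> bool"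
  where "generates_evolution_family T D A U \<longleftrightarrow>
    evolution_family T U \<and>
    (\<exists>C\<ge>1.
      (\<forall>t s. 0 \<le> s \<and> s \<le> t \<and> t \<le> T \<longrightarrow> norm (U t s) \<le> C) \<and>
      (\<forall>t s. 0 \<le> s \<and> s < t \<and> t \<le> T \<longrightarrow>
         (\<forall>x. U t s x \<in> D t) \<and>
         (\<forall>x. ((\<lambda>r. U r s x) has_vector_derivative A t (U t s x)) (at t within {s..T})) \<and>
         opnorm_le (\<lambda>x. A t (U t s x)) (C / (t - s))) \<and>
      (\<forall>t s. 0 \<le> s \<and> s \<le> t \<and> t \<le> T \<longrightarrow>
         opnorm_le (\<lambda>x. A t (U t s (inv_into (D s) (A s) x))) C)) \<and>
    (\<forall>t s. 0 \<le> s \<and> s \<le> t \<and> t \<le> T \<longrightarrow>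
       (\<forall>v\<in>D s. ((\<lambda>r. U t r v) has_vector_derivative - U t s (A s v)) (at s within {0..t})))"

section \<open>Function spaces on the interval\<close>

text \<open>\<open>PC T P\<close> is the space of piecewise continuous functions with exceptional points in \<open>P\<close>.\<close>

definition PC :: "real \<Rightarrow> real set \<Rightarrow> (real \<Rightarrow> 'a::real_normed_vector) set"
  where "PC T P = {x. continuous_on ({0..T} - P) x \<and>
    (\<forall>p\<in>P. (x \<longlongrightarrow> x p) (at_left p) \<and> (\<exists>l. (x \<longlongrightarrow> l) (at_right p)))}"

definition PC_norm :: "real \<Rightarrow> (real \<Rightarrow> 'a::real_normed_vector) \<Rightarrow> real"
  where "PC_norm T x = (SUP s\<in>{0..T}. norm (x s))"

definition L1 :: "real \<Rightarrow> (real \<Rightarrow> 'a::{banach, second_countable_topology}) set"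
  where "L1 T = {h. integrable (lebesgue_on {0..T}) h}"

text \<open>Functions are not identified almost everywhere in \<^const>\<open>L1\<close>.  The bound makes every functional
  in \<open>L1_dual\<close> vanish on functions that are zero almost everywhere, so \<open>L1_dual\<close> is the dual of the
  quotient space.\<close>

definition L1_dual ::
  "real \<Rightarrow> ((real \<Rightarrow> 'a::{complex_normed_vector, banach, second_countable_topology}) \<Rightarrow> complex) set"
  where "L1_dual T = {\<phi>.
    (\<forall>f\<in>L1 T. \<forall>g\<in>L1 T. \<phi> (\<lambda>s. f s + g s) = \<phi> f + \<phi> g) \<and>
    (\<forall>c. \<forall>f\<in>L1 T. \<phi> (\<lambda>s. c *\<^sub>C f s) = c * \<phi> f) \<and>
    (\<exists>M. \<forall>f\<in>L1 T. cmod (\<phi> f) \<le> M * integral\<^sup>L (lebesgue_on {0..T}) (\<lambda>s. norm (f s)))}"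

definition weakly_converges_L1 ::
  "real \<Rightarrow> (nat \<Rightarrow> real \<Rightarrow> 'a::{complex_normed_vector, banach, second_countable_topology}) \<Rightarrow>
   (real \<Rightarrow> 'a) \<Rightarrow> bool"
  where "weakly_converges_L1 T hs h \<longleftrightarrow>
    (\<forall>n. hs n \<in> L1 T) \<and> h \<in> L1 T \<and> (\<forall>\<phi>\<in>L1_dual T. (\<lambda>n. \<phi> (hs n)) \<longlonglongrightarrow> \<phi> h)"

definition integrably_bounded ::
  "real \<Rightarrow> (nat \<Rightarrow> real \<Rightarrow> 'a::{banach, second_countable_topology}) \<Rightarrow> bool"
  where "integrably_bounded T hs \<longleftrightarrow>
    (\<forall>n. hs n \<in> L1 T) \<and>
    (\<exists>\<sigma>::real \<Rightarrow> real. \<sigma> \<in> L1 T \<and> (\<forall>t\<in>{0..T}. 0 \<le> \<sigma> t) \<and>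
       (\<forall>n. AE t in lebesgue_on {0..T}. norm (hs n t) \<le> \<sigma> t))"

definition G ::
  "(real \<Rightarrow> real \<Rightarrow> 'a::{banach, second_countable_topology} \<Rightarrow>\<^sub>L 'a) \<Rightarrow> (real \<Rightarrow> 'a) \<Rightarrow> real \<Rightarrow> 'a"
  where "G U h t = integral\<^sup>L (lebesgue_on {0..t}) (\<lambda>s. U t s (h s))"

end

theory Submission
  imports Defs
begin

text \<open>
Write \<open>u\<^sub>n = h\<^sub>n - h\<close>.  This sequence is weakly null in \<open>L\<^sup>1\<close> and dominated by one integrable function \<open>\<sigma>\<close>,
and by linearity of \<open>G\<close> it has to be shown that \<open>G u\<^sub>n\<close> tends to zero uniformly on \<open>[0, T]\<close>.  Everything
rests on the splitting, for \<open>r \<le> t\<close>,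

  \<open>(G u)(t) = U(t, r) (G u)(r) + \<integral>\<^sub>r\<^sup>t U(t, s) u(s) ds\<close>   (lemma \<open>G_split\<close>),

in which the last integral is at most \<open>C \<integral>\<^sub>r\<^sup>t \<sigma>\<close>, hence small uniformly in the sequence as soon as \<open>t - r\<close>
is small.

For a fixed \<open>t > 0\<close> take \<open>r < t\<close> close to \<open>t\<close>.  Composing a functional on the space with \<open>u \<mapsto> (G u)(r)\<close>
gives a functional on \<open>L\<^sup>1\<close>, so \<open>(G u\<^sub>n)(r)\<close> is weakly null, and the compact operator \<open>U(t, r)\<close> turns
this into norm convergence; thus \<open>(G u\<^sub>n)(t)\<close> tends to zero.  The passage from pointwise to uniform
convergence uses the splitting again: if \<open>r\<close> is the last point up to \<open>t\<close> of a fine finite grid, then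
\<open>(G u\<^sub>n)(t)\<close> is controlled by \<open>C \<parallel>(G u\<^sub>n)(r)\<parallel>\<close> and a small remainder, so convergence at the finitely many
grid points suffices.  The same splitting shows that \<open>G h\<close> is continuous.

Two ingredients are proved along the way.  The operator \<open>U(t, s)\<close> is compact for \<open>s < t\<close> because it equals
\<open>R(\<lambda>, A(t))\<close> applied to the bounded operator \<open>\<lambda> U(t, s) - A(t) U(t, s)\<close>
(lemma \<open>generated_evolution_family_compact\<close>).  That compact operators map weakly null sequences to null
sequences needs a dual that separates points, that is, the Hahn-Banach theorem
(lemma \<open>complex_dual_separates_points\<close>); it is derived from Zorn's lemma by way of minimal sublinear
functionals.
\<close>

section \<open>The Hahn-Banach theorem\<close>

definition sublinear :: "('a::real_vector \<Rightarrow> real) \<Rightarrow> bool"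
  where "sublinear p \<longleftrightarrow>
    (\<forall>x y. p (x + y) \<le> p x + p y) \<and> (\<forall>c\<ge>0. \<forall>x. p (c *\<^sub>R x) = c * p x)"

text \<open>One inequality for positive scalars is enough: the reverse one is the same inequality for the inverse
scalar.\<close>

lemma sublinearI:
  assumes add: "\<And>x y. p (x + y) \<le> p x + p y"
    and zero: "p 0 = 0"
    and scale: "\<And>c x. c > 0 \<Longrightarrow> p (c *\<^sub>R x) \<le> c * p x"
  shows "sublinear p"
proof -
  have "p (c *\<^sub>R x) = c * p x" if "c \<ge> 0" for c x
  proof (cases "c = 0")
    case False
    with that have c: "c > 0" by simp
    have "p ((1 / c) *\<^sub>R (c *\<^sub>R x)) \<le> (1 / c) * p (c *\<^sub>R x)"
      using c by (intro scale) simp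
    then have "c * p x \<le> p (c *\<^sub>R x)" using c by (simp add: field_simps)
    with scale[OF c, of x] show ?thesis by simp
  qed (simp add: zero)
  with add show ?thesis by (simp add: sublinear_def)
qed

lemma sublinear_add: "sublinear p \<Longrightarrow> p (x + y) \<le> p x + p y"
  and sublinear_scale: "sublinear p \<Longrightarrow> c \<ge> 0 \<Longrightarrow> p (c *\<^sub>R x) = c * p x"
  by (auto simp: sublinear_def)

lemma sublinear_zero: "sublinear p \<Longrightarrow> p 0 = 0"
  using sublinear_scale[of p 0 0] by simp

lemma sublinear_lower: "sublinear p \<Longrightarrow> - p (- x) \<le> p x"
  using sublinear_add[of p x "- x"] by (simp add: sublinear_zero)

text \<open>Lowering a sublinear \<open>p\<close> as far as possible in the direction \<open>- y\<close>: the function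
\<open>q(x) = inf {p(x + t y) - t p(y) | t \<ge> 0}\<close> is still sublinear, and \<open>t = 1\<close> bounds its value at \<open>- y\<close>.
This shows that a minimal sublinear functional is odd, and applied to the norm it also produces a
majorant whose linear minorants take at least the value \<open>norm y\<close> at \<open>y\<close>.\<close>

lemma sublinear_tilt:
  fixes p :: "'a::real_vector \<Rightarrow> real"
  assumes p: "sublinear p"
  obtains q where "sublinear q" "\<And>x. q x \<le> p x" "q (- y) \<le> - p y"
proof
  define q where "q x = (INF t\<in>{0..}. p (x + t *\<^sub>R y) - t * p y)" for x
  have below: "- p (- x) \<le> p (x + t *\<^sub>R y) - t * p y" if "t \<ge> 0" for x t
    using sublinear_add[OF p, of "x + t *\<^sub>R y" "- x"] sublinear_scale[OF p that, of y] by simp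
  have q_le: "q x \<le> p (x + t *\<^sub>R y) - t * p y" if "t \<ge> 0" for x t
    unfolding q_def by (rule cINF_lower) (use that below in \<open>auto intro!: bdd_belowI2\<close>)
  have q_ge: "b \<le> q x" if "\<And>t. t \<ge> 0 \<Longrightarrow> b \<le> p (x + t *\<^sub>R y) - t * p y" for b x
    unfolding q_def by (rule cINF_greatest) (use that in auto)
  show "sublinear q"
  proof (rule sublinearI)
    fix x z
    have "q (x + z) - (p (x + t *\<^sub>R y) - t * p y) \<le> p (z + s *\<^sub>R y) - s * p y"
      if "t \<ge> 0" "s \<ge> 0" for t s
      using q_le[of "t + s" "x + z"] sublinear_add[OF p, of "x + t *\<^sub>R y" "z + s *\<^sub>R y"] that
      by (simp add: algebra_simps)
    then have "q (x + z) - q z \<le> p (x + t *\<^sub>R y) - t * p y" if "t \<ge> 0" for t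
      using q_ge[of "q (x + z) - (p (x + t *\<^sub>R y) - t * p y)" z] that by force
    then show "q (x + z) \<le> q x + q z"
      using q_ge[of "q (x + z) - q z" x] by force
  next
    show "q 0 = 0"
      using q_le[of 0 0] q_ge[of 0 0] sublinear_zero[OF p] sublinear_scale[OF p] by force
  next
    fix c :: real and x assume c: "c > 0"
    have "q (c *\<^sub>R x) / c \<le> p (x + t *\<^sub>R y) - t * p y" if "t \<ge> 0" for t
      using q_le[of "c * t" "c *\<^sub>R x"] sublinear_scale[OF p, of c "x + t *\<^sub>R y"] c that
      by (simp add: field_simps scaleR_add_right)
    then show "q (c *\<^sub>R x) \<le> c * q x"
      using q_ge[of "q (c *\<^sub>R x) / c" x] c by (simp add: field_simps)
  qed
  show "q x \<le> p x" for x using q_le[of 0 x] by simp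
  show "q (- y) \<le> - p y" using q_le[of 1 "- y"] sublinear_zero[OF p] by simp
qed

text \<open>The hypothesis of Zorn's lemma for sublinear functionals below \<open>p0\<close>.  The infimum is finite because
every member lies above \<open>x \<mapsto> - p0 (- x)\<close>, and it is subadditive because two members of a chain have a
smaller one among them.\<close>

lemma sublinear_chain_Inf:
  fixes \<C> :: "('a::real_vector \<Rightarrow> real) set"
  assumes ne: "\<C> \<noteq> {}"
    and sub: "\<And>p. p \<in> \<C> \<Longrightarrow> sublinear p \<and> p \<le> p0"
    and chain: "\<And>p q. p \<in> \<C> \<Longrightarrow> q \<in> \<C> \<Longrightarrow> p \<le> q \<or> q \<le> p"
  obtains u where "sublinear u" "\<And>p. p \<in> \<C> \<Longrightarrow> u \<le> p"
proof
  define u where "u x = (INF p\<in>\<C>. p x)" for x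
  have "- p0 (- x) \<le> p x" if "p \<in> \<C>" for p x
    using sublinear_lower[of p x] le_funD[of p p0 "- x"] sub[OF that] by linarith
  then have u_le: "u x \<le> p x" if "p \<in> \<C>" for p x
    unfolding u_def by (intro cINF_lower) (use that in \<open>auto intro!: bdd_belowI2\<close>)
  have u_ge: "b \<le> u x" if "\<And>p. p \<in> \<C> \<Longrightarrow> b \<le> p x" for b x
    unfolding u_def by (rule cINF_greatest) (use that ne in auto)
  show "sublinear u"
  proof (rule sublinearI)
    fix x y
    have "u (x + y) - p x \<le> q y" if pq: "p \<in> \<C>" "q \<in> \<C>" for p q
    proof -
      obtain r where r: "r \<in> \<C>" "r \<le> p" "r \<le> q"
        using chain[OF pq] pq by (metis order_refl)
      have "u (x + y) \<le> r x + r y"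
        using u_le[OF r(1), of "x + y"] sublinear_add[of r x y] sub[OF r(1)] by simp
      also have "\<dots> \<le> p x + q y" using r by (simp add: le_fun_def add_mono)
      finally show ?thesis by simp
    qed
    then have "u (x + y) - u y \<le> p x" if "p \<in> \<C>" for p
      using u_ge[of "u (x + y) - p x" y] that by force
    then show "u (x + y) \<le> u x + u y" using u_ge[of "u (x + y) - u y" x] by force
  next
    have "(\<lambda>p. p 0) ` \<C> = {0}" using sub sublinear_zero ne by force
    then show "u 0 = 0" by (simp add: u_def)
  next
    fix c :: real and x assume c: "c > 0"
    have "u (c *\<^sub>R x) / c \<le> p x" if "p \<in> \<C>" for p
      using u_le[OF that, of "c *\<^sub>R x"] sublinear_scale[of p c x] sub[OF that] c
      by (simp add: field_simps)
    then show "u (c *\<^sub>R x) \<le> c * u x"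
      using u_ge[of "u (c *\<^sub>R x) / c" x] c by (simp add: field_simps)
  qed
  show "u \<le> p" if "p \<in> \<C>" for p using u_le[OF that] by (simp add: le_fun_def)
qed

text \<open>A minimal sublinear functional is linear: minimality and \<open>sublinear_tilt\<close> make it odd, and an odd
subadditive function is additive.\<close>

lemma linear_below_sublinear:
  fixes p :: "'a::real_vector \<Rightarrow> real"
  assumes p: "sublinear p"
  obtains f where "linear f" "\<And>x. f x \<le> p x"
proof -
  define S where "S = {q. sublinear q \<and> q \<le> p}"
  have "\<exists>m\<in>S. \<forall>a\<in>S. m \<ge> a \<longrightarrow> a = m"
  proof (rule predicate_Zorn)
    show "partial_order_on S (relation_of (\<ge>) S)"
      by (auto simp: partial_order_on_def preorder_on_def refl_on_def trans_def antisym_def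
          relation_of_def)
    fix \<C> assume "\<C> \<in> Chains (relation_of (\<ge>) S)"
    then have S: "\<And>q. q \<in> \<C> \<Longrightarrow> q \<in> S" and chain: "\<And>q r. q \<in> \<C> \<Longrightarrow> r \<in> \<C> \<Longrightarrow> q \<le> r \<or> r \<le> q"
      by (auto simp: Chains_def relation_of_def)
    show "\<exists>u\<in>S. \<forall>a\<in>\<C>. a \<ge> u"
    proof (cases "\<C> = {}")
      case True
      then show ?thesis using p by (auto simp: S_def)
    next
      case False
      obtain u where "sublinear u" "\<And>q. q \<in> \<C> \<Longrightarrow> u \<le> q"
        using sublinear_chain_Inf[OF False, of p] S chain unfolding S_def by blast
      then show ?thesis using False S unfolding S_def by (blast intro: order_trans)
    qed
  qed
  then obtain f where f: "sublinear f" "f \<le> p"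
    and min: "\<And>q. sublinear q \<Longrightarrow> q \<le> p \<Longrightarrow> q \<le> f \<Longrightarrow> q = f"
    by (auto simp: S_def)
  have neg: "f (- y) = - f y" for y
  proof -
    obtain q where q: "sublinear q" "q \<le> f" "q (- y) \<le> - f y"
      using sublinear_tilt[OF f(1), of y] by (metis le_funI)
    then have "q = f" using f(2) min by (meson order_trans)
    with q(3) sublinear_lower[OF f(1), of y] show ?thesis by simp
  qed
  have "linear f"
  proof (rule linearI)
    show "f (x + y) = f x + f y" for x y
      using sublinear_add[OF f(1), of x y] sublinear_add[OF f(1), of "x + y" "- y"] neg[of y] by simp
    show "f (c *\<^sub>R x) = c *\<^sub>R f x" for c x
      using sublinear_scale[OF f(1), of c x] sublinear_scale[OF f(1), of "- c" x] neg[of "c *\<^sub>R x"]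
      by (cases "c \<ge> 0") auto
  qed
  with f(2) show ?thesis by (intro that) (auto simp: le_fun_def)
qed

lemma bounded_linear_scaleC:
  "bounded_linear (\<lambda>x. c *\<^sub>C (x::'a::complex_normed_vector))"
proof (rule bounded_linear_intro[where K="cmod c"])
  show "c *\<^sub>C (x + y) = c *\<^sub>C x + c *\<^sub>C y" for x y :: 'a by (rule scaleC_add_right)
  show "c *\<^sub>C (r *\<^sub>R x) = r *\<^sub>R (c *\<^sub>C x)" for r and x :: 'a
    by (simp add: scaleR_scaleC scaleC_scaleC mult.commute)
  show "norm (c *\<^sub>C x) \<le> norm x * cmod c" for x :: 'a by (simp add: norm_scaleC)
qed

text \<open>A real functional \<open>g\<close> is the real part of the complex functional \<open>x \<mapsto> g x - \<i> g (\<i> x)\<close>.  To make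
\<open>g z \<ge> norm z\<close>, \<open>g\<close> is chosen below the norm tilted in the direction of \<open>z\<close>.\<close>

lemma complex_dual_separates_points:
  fixes z :: "'a::complex_normed_vector"
  assumes "z \<noteq> 0"
  obtains f where "f \<in> complex_dual" "blinfun_apply f z \<noteq> 0"
proof -
  have norm: "sublinear (norm :: 'a \<Rightarrow> real)"
    by (simp add: sublinear_def norm_triangle_ineq)
  obtain p where p: "sublinear p" "\<And>x. p x \<le> norm x" "p (- z) \<le> - norm z"
    using sublinear_tilt[OF norm, of z] by blast
  obtain g where g: "linear g" "\<And>x. g x \<le> p x" using linear_below_sublinear[OF p(1)] by blast
  have "g z \<ge> norm z" using g(2)[of "- z"] p(3) linear_neg[OF g(1), of z] by simp
  with assms have gz: "g z > 0" by (meson less_le_trans zero_less_norm_iff)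
  have g_bound: "\<bar>g x\<bar> \<le> norm x" for x
    using g(2)[of x] p(2)[of x] g(2)[of "- x"] p(2)[of "- x"] linear_neg[OF g(1), of x]
    by simp
  have g_lin: "bounded_linear g"
    by (rule bounded_linear_intro[where K=1])
      (use g(1) g_bound in \<open>auto simp: linear_add linear_cmul\<close>)
  define f where "f x = Complex (g x) (- g (\<i> *\<^sub>C x))" for x
  have "f = (\<lambda>x. of_real (g x) - \<i> * of_real (g (\<i> *\<^sub>C x)))"
    by (auto simp: f_def complex_eq_iff)
  moreover have "bounded_linear (\<lambda>x. of_real (g x) - \<i> * of_real (g (\<i> *\<^sub>C x)))"
    by (intro bounded_linear_sub bounded_linear_const_mult
        bounded_linear_compose[OF bounded_linear_of_real]
        bounded_linear_compose[OF g_lin bounded_linear_scaleC] g_lin)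
  ultimately have f: "bounded_linear f" by simp
  have "f (c *\<^sub>C x) = c * f x" for c x
  proof -
    have split: "g (d *\<^sub>C x) = Re d * g x + Im d * g (\<i> *\<^sub>C x)" for d
    proof -
      have "d *\<^sub>C x = Re d *\<^sub>R x + Im d *\<^sub>R (\<i> *\<^sub>C x)"
        by (simp add: scaleR_scaleC scaleC_scaleC flip: scaleC_add_left)
          (metis complex_eq mult.commute)
      then show ?thesis using g(1) by (simp add: linear_add linear_cmul)
    qed
    show ?thesis
      using split[of c] split[of "\<i> * c"] by (simp add: f_def scaleC_scaleC complex_eq_iff algebra_simps)
  qed
  then have "Blinfun f \<in> complex_dual"
    unfolding complex_dual_def by (simp add: bounded_linear_Blinfun_apply[OF f])
  moreover have "blinfun_apply (Blinfun f) z \<noteq> 0"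
    using gz by (simp add: bounded_linear_Blinfun_apply[OF f] f_def complex_eq_iff)
  ultimately show ?thesis by (rule that)
qed

section \<open>Weakly null sequences and compact operators\<close>

text \<open>Every subsequence has a norm convergent subsequence, and every functional vanishes at its limit; as
the dual separates points, the limit is zero.\<close>

lemma weakly_null_in_compact_imp_null:
  fixes x :: "nat \<Rightarrow> 'a::complex_normed_vector"
  assumes S: "compact S" and x: "\<And>n. x n \<in> S"
    and weak: "\<And>f. f \<in> complex_dual \<Longrightarrow> (\<lambda>n. blinfun_apply f (x n)) \<longlonglongrightarrow> 0"
  shows "x \<longlonglongrightarrow> 0"
proof (rule ccontr)
  assume "\<not> x \<longlonglongrightarrow> 0"
  then obtain e where e: "e > 0" and "\<exists>\<^sub>F n in sequentially. e \<le> dist (x n) 0"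
    by (auto simp: tendsto_iff not_eventually not_less)
  then obtain r :: "nat \<Rightarrow> nat" where r: "strict_mono r" and far: "\<And>n. e \<le> dist (x (r n)) 0"
    using infinite_enumerate[of "{n. e \<le> dist (x n) 0}"]
    by (auto simp: frequently_cofinite cofinite_eq_sequentially[symmetric])
  obtain l q where q: "strict_mono (q :: nat \<Rightarrow> nat)" and lim: "(\<lambda>n. x (r (q n))) \<longlonglongrightarrow> l"
    using S[unfolded compact_def, rule_format, of "\<lambda>n. x (r n)"] x by (auto simp: comp_def)
  have "l = 0"
  proof (rule ccontr)
    assume "l \<noteq> 0"
    then obtain f where f: "f \<in> complex_dual" "blinfun_apply f l \<noteq> 0"
      by (rule complex_dual_separates_points)
    have "(\<lambda>n. blinfun_apply f (x (r (q n)))) \<longlonglongrightarrow> blinfun_apply f l"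
      by (intro tendsto_intros lim)
    moreover have "(\<lambda>n. blinfun_apply f (x (r (q n)))) \<longlonglongrightarrow> 0"
      using LIMSEQ_subseq_LIMSEQ[OF weak[OF f(1)] strict_mono_o[OF r q]] by (simp add: comp_def)
    ultimately show False using f(2) LIMSEQ_unique by blast
  qed
  with lim e have "eventually (\<lambda>n. dist (x (r (q n))) 0 < e) sequentially"
    by (simp add: tendsto_iff)
  with far show False by (auto simp: not_less[symmetric])
qed

text \<open>The images \<open>K (y n)\<close> lie in a multiple of the compact closure of \<open>K\<close> applied to the unit ball; the factor
\<open>\<bar>M\<bar> + 1\<close> is a bound for the sequence that is also positive.\<close>

lemma compact_operator_weakly_null:
  fixes K :: "'a::complex_normed_vector \<Rightarrow> 'a"
  assumes K: "compact_operator K" and K_scaleC: "\<And>c x. K (c *\<^sub>C x) = c *\<^sub>C K x"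
    and bound: "\<And>n. norm (y n) \<le> M"
    and weak: "\<And>f. f \<in> complex_dual \<Longrightarrow> (\<lambda>n. blinfun_apply f (y n)) \<longlonglongrightarrow> 0"
  shows "(\<lambda>n. K (y n)) \<longlonglongrightarrow> 0"
proof (rule weakly_null_in_compact_imp_null)
  have lin: "bounded_linear K" and "compact (closure (K ` cball 0 1))"
    using K by (auto simp: compact_operator_def)
  then show "compact ((*\<^sub>R) (\<bar>M\<bar> + 1) ` closure (K ` cball 0 1))" by (simp add: compact_scaling)
  show "K (y n) \<in> (*\<^sub>R) (\<bar>M\<bar> + 1) ` closure (K ` cball 0 1)" for n
  proof
    show "K (y n) = (\<bar>M\<bar> + 1) *\<^sub>R K ((1 / (\<bar>M\<bar> + 1)) *\<^sub>R y n)"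
      by (simp add: linear_cmul[OF bounded_linear.linear[OF lin]]) linarith
    have "(1 / (\<bar>M\<bar> + 1)) *\<^sub>R y n \<in> cball 0 1"
      using bound[of n] by (auto simp: divide_le_eq)
    then show "K ((1 / (\<bar>M\<bar> + 1)) *\<^sub>R y n) \<in> closure (K ` cball 0 1)"
      by (rule subsetD[OF closure_subset imageI])
  qed
  fix f :: "'a \<Rightarrow>\<^sub>L complex" assume f: "f \<in> complex_dual"
  have "blinfun_apply (f o\<^sub>L Blinfun K) x = blinfun_apply f (K x)" for x
    by (simp add: bounded_linear_Blinfun_apply[OF lin])
  moreover from this have "f o\<^sub>L Blinfun K \<in> complex_dual"
    using f by (simp add: complex_dual_def K_scaleC)
  ultimately show "(\<lambda>n. blinfun_apply f (K (y n))) \<longlonglongrightarrow> 0"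
    using weak[of "f o\<^sub>L Blinfun K"] by simp
qed

section \<open>Integrals over subintervals\<close>

lemma integrable_lebesgue_on_subset:
  fixes f :: "real \<Rightarrow> 'b::{banach, second_countable_topology}"
  assumes f: "integrable (lebesgue_on {a..b}) f" and sub: "{c..d} \<subseteq> {a..b}"
  shows "integrable (lebesgue_on {c..d}) f"
  using set_integrable_subset[of lebesgue "{a..b}" f "{c..d}"] f sub
  by (simp add: set_integrable_def integrable_restrict_space)

lemma integral_lebesgue_on_combine:
  fixes f :: "real \<Rightarrow> 'b::{banach, second_countable_topology}"
  assumes f: "integrable (lebesgue_on {a..c}) f" and "a \<le> b" "b \<le> c"
  shows "integral\<^sup>L (lebesgue_on {a..c}) f =
    integral\<^sup>L (lebesgue_on {a..b}) f + integral\<^sup>L (lebesgue_on {b..c}) f"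
proof -
  have "{a..c} = {a..b} \<union> {b..c}" using assms by auto
  moreover have "AE x in lebesgue. \<not> (x \<in> {a..b} \<and> x \<in> {b..c})"
    using AE_completion[OF AE_lborel_singleton[of b]] by eventually_elim auto
  moreover have "integrable (lebesgue_on {a..b}) f" "integrable (lebesgue_on {b..c}) f"
    using assms by (auto intro!: integrable_lebesgue_on_subset[OF f])
  ultimately show ?thesis
    using set_integral_Un_AE[where M=lebesgue and A="{a..b}" and B="{b..c}" and f=f]
    by (simp add: set_integrable_def set_lebesgue_integral_def integrable_restrict_space
        integral_restrict_space)
qed

lemma AE_lebesgue_on_interval:
  fixes a b :: real
  shows "(AE s in lebesgue_on {a..b}. P s) \<longleftrightarrow> (AE s in lebesgue. s \<in> {a..b} \<longrightarrow> P s)"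
  by (rule AE_restrict_space_iff) simp

text \<open>The indefinite integral is uniformly continuous.\<close>

lemma integral_small_on_short_intervals:
  fixes \<sigma> :: "real \<Rightarrow> real"
  assumes \<sigma>: "integrable (lebesgue_on {0..T}) \<sigma>" and "e > 0"
  obtains d where "d > 0"
    "\<And>a b. 0 \<le> a \<Longrightarrow> a \<le> b \<Longrightarrow> b \<le> T \<Longrightarrow> b - a < d \<Longrightarrow> integral\<^sup>L (lebesgue_on {a..b}) \<sigma> < e"
proof -
  have "continuous_on {0..T} (\<lambda>x. integral {0..x} \<sigma>)"
    using \<sigma> by (intro indefinite_integral_continuous_1 integrable_on_lebesgue_on) auto
  then have "uniformly_continuous_on {0..T} (\<lambda>x. integral {0..x} \<sigma>)"
    by (intro compact_uniformly_continuous) auto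
  then obtain d where "d > 0" and d: "\<And>x y. x \<in> {0..T} \<Longrightarrow> y \<in> {0..T} \<Longrightarrow> dist y x < d \<Longrightarrow>
      dist (integral {0..y} \<sigma>) (integral {0..x} \<sigma>) < e"
    using \<open>e > 0\<close> unfolding uniformly_continuous_on_def by metis
  show ?thesis
  proof (rule that[OF \<open>d > 0\<close>])
    fix a b assume ab: "0 \<le> a" "a \<le> b" "b \<le> T" "b - a < d"
    have int: "integrable (lebesgue_on {0..r}) \<sigma>" if "r \<le> T" for r
      using that by (intro integrable_lebesgue_on_subset[OF \<sigma>]) auto
    have "integral\<^sup>L (lebesgue_on {a..b}) \<sigma> = integral {0..b} \<sigma> - integral {0..a} \<sigma>"
      using integral_lebesgue_on_combine[OF int ab(1,2)] ab lebesgue_integral_eq_integral[OF int]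
      by simp
    then show "integral\<^sup>L (lebesgue_on {a..b}) \<sigma> < e"
      using d[of a b] ab by (simp add: dist_real_def)
  qed
qed

lemma L1_integrable:
  assumes "h \<in> L1 T" "0 \<le> a" "b \<le> T"
  shows "integrable (lebesgue_on {a..b}) h"
  using assms integrable_lebesgue_on_subset[of 0 T h a b] by (simp add: L1_def)

lemma L1_norm: "h \<in> L1 T \<Longrightarrow> (\<lambda>s. norm (h s)) \<in> L1 T"
  by (simp add: L1_def)

section \<open>The Volterra operator of a bounded evolution family\<close>

locale bounded_evolution_family =
  fixes T C :: real
    and U :: "real \<Rightarrow> real \<Rightarrow>
      'a::{complex_normed_vector, banach, second_countable_topology} \<Rightarrow>\<^sub>L 'a"
  assumes evolution: "evolution_family T U"
    and norm_U: "0 \<le> s \<Longrightarrow> s \<le> t \<Longrightarrow> t \<le> T \<Longrightarrow> norm (U t s) \<le> C"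
begin

lemma U_scaleC: "0 \<le> s \<Longrightarrow> s \<le> t \<Longrightarrow> t \<le> T \<Longrightarrow> U t s (c *\<^sub>C x) = c *\<^sub>C U t s x"
  using evolution unfolding evolution_family_def by blast

lemma U_comp:
  assumes "0 \<le> s" "s \<le> r" "r \<le> t" "t \<le> T"
  shows "U t r (U r s x) = U t s x"
proof -
  have "U t r o\<^sub>L U r s = U t s"
    using evolution assms unfolding evolution_family_def by blast
  then show ?thesis by (simp flip: blinfun_apply_blinfun_compose)
qed

lemma U_continuous: "continuous_on {(t, s). 0 \<le> s \<and> s \<le> t \<and> t \<le> T} (\<lambda>(t, s). U t s x)"
  using evolution unfolding evolution_family_def by blast

lemma C_nonneg: "0 \<le> t \<Longrightarrow> t \<le> T \<Longrightarrow> C \<ge> 0"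
  using order_trans[OF norm_ge_zero norm_U[of t t]] by simp

lemma norm_U_apply: "0 \<le> s \<Longrightarrow> s \<le> t \<Longrightarrow> t \<le> T \<Longrightarrow> norm (U t s x) \<le> C * norm x"
  by (meson norm_U norm_blinfun mult_right_mono norm_ge_zero order_trans)

text \<open>Strong continuity and the uniform bound on the norms give joint continuity in the time and the
vector.  This is what makes \<open>s \<mapsto> U t s (h s)\<close> measurable for measurable \<open>h\<close>.\<close>

lemma continuous_on_U_apply_pair:
  assumes t: "t \<le> T"
  shows "continuous_on ({0..t} \<times> UNIV) (\<lambda>(s, x). U t s x)"
proof -
  have "((\<lambda>p. U t (fst p) (snd p)) \<longlongrightarrow> U t (fst q) (snd q)) (at q within {0..t} \<times> UNIV)" (is "(_ \<longlongrightarrow> _) ?F")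
    if q: "q \<in> {0..t} \<times> UNIV" for q
  proof -
    have "continuous_on ({0..t} \<times> (UNIV :: 'a set))
        (\<lambda>p. (\<lambda>(t, s). U t s (snd q)) (t, fst p))"
      using t by (intro continuous_on_compose2[OF U_continuous] continuous_intros) auto
    from this[unfolded continuous_on_def, rule_format, OF q]
    have "((\<lambda>p. U t (fst p) (snd q)) \<longlongrightarrow> U t (fst q) (snd q)) ?F" by simp
    moreover have "((\<lambda>p. U t (fst p) (snd p - snd q)) \<longlongrightarrow> 0) ?F"
    proof (rule Lim_null_comparison)
      show "\<forall>\<^sub>F p in ?F. norm (U t (fst p) (snd p - snd q)) \<le> C * norm (snd p - snd q)"
        using t by (auto simp: eventually_at_filter intro!: always_eventually norm_U_apply)
      show "((\<lambda>p. C * norm (snd p - snd q)) \<longlongrightarrow> 0) ?F"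
      proof -
        have "((\<lambda>p. C * norm (snd p - snd q)) \<longlongrightarrow> C * norm (snd q - snd q)) ?F"
          by (intro tendsto_intros)
        then show ?thesis by simp
      qed
    qed
    ultimately have "((\<lambda>p. U t (fst p) (snd q) + U t (fst p) (snd p - snd q)) \<longlongrightarrow>
        U t (fst q) (snd q) + 0) ?F"
      by (rule tendsto_add)
    then show ?thesis by (simp add: blinfun.diff_right)
  qed
  then show ?thesis by (simp add: continuous_on_def split_beta)
qed

lemma integrable_U_apply:
  assumes h: "h \<in> L1 T" and "0 \<le> a" "b \<le> t" "t \<le> T"
  shows "integrable (lebesgue_on {a..b}) (\<lambda>s. U t s (h s))"
proof (cases "a \<le> b")
  case True
  have int: "integrable (lebesgue_on {a..b}) h"
    using assms by (intro L1_integrable[OF h]) auto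
  \<comment> \<open>Clamping the time to \<open>[a, b]\<close> extends the map continuously to the whole space.\<close>
  have "continuous_on UNIV (\<lambda>p. (\<lambda>(s, x). U t s x) (max a (min b (fst p)), snd p))"
    by (rule continuous_on_compose2[OF continuous_on_U_apply_pair[OF \<open>t \<le> T\<close>]])
      (use assms True in \<open>auto intro!: continuous_intros\<close>)
  then have F: "(\<lambda>p. U t (max a (min b (fst p))) (snd p)) \<in> borel_measurable borel"
    by (intro borel_measurable_continuous_onI) simp
  have "(\<lambda>s. s) \<in> borel_measurable (lebesgue_on {a..b})"
    by (intro measurable_restrict_space1 measurable_completion) simp
  then have "(\<lambda>s. (s, h s)) \<in> borel_measurable (lebesgue_on {a..b})"
    using borel_measurable_integrable[OF int] by (rule borel_measurable_Pair)
  from measurable_compose[OF this F]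
  have "(\<lambda>s. U t (max a (min b s)) (h s)) \<in> borel_measurable (lebesgue_on {a..b})"
    by simp
  then have "(\<lambda>s. U t s (h s)) \<in> borel_measurable (lebesgue_on {a..b})"
    by (rule measurable_cong[THEN iffD1, rotated]) simp
  moreover have "AE s in lebesgue_on {a..b}. norm (U t s (h s)) \<le> norm (C * norm (h s))"
    using assms by (intro AE_I2 order_trans[OF norm_U_apply]) auto
  ultimately show ?thesis
    using integrable_mult_right[OF integrable_norm[OF int]]
    by (rule Bochner_Integration.integrable_bound[rotated])
next
  case False
  then have "{a..b} = {}" by simp
  then show ?thesis by (simp only: integrable_lebesgue_on_empty)
qed

lemma norm_integral_U_apply_le:
  assumes h: "h \<in> L1 T" and \<sigma>: "\<sigma> \<in> L1 T"
    and bound: "AE s in lebesgue_on {0..T}. norm (h s) \<le> \<sigma> s"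
    and ab: "0 \<le> a" "b \<le> t" "t \<le> T"
  shows "norm (integral\<^sup>L (lebesgue_on {a..b}) (\<lambda>s. U t s (h s))) \<le>
    C * integral\<^sup>L (lebesgue_on {a..b}) \<sigma>"
proof -
  have "AE s in lebesgue. s \<in> {0..T} \<longrightarrow> norm (h s) \<le> \<sigma> s"
    using bound unfolding AE_lebesgue_on_interval .
  then have "AE s in lebesgue. s \<in> {a..b} \<longrightarrow> norm (U t s (h s)) \<le> C * \<sigma> s"
  proof eventually_elim
    case (elim s)
    show ?case
    proof
      assume s: "s \<in> {a..b}"
      then have "norm (U t s (h s)) \<le> C * norm (h s)" using ab by (intro norm_U_apply) auto
      also have "\<dots> \<le> C * \<sigma> s"
        using elim s ab C_nonneg[of t] by (intro mult_left_mono) auto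
      finally show "norm (U t s (h s)) \<le> C * \<sigma> s" .
    qed
  qed
  then have AE: "AE s in lebesgue_on {a..b}. norm (U t s (h s)) \<le> C * \<sigma> s"
    unfolding AE_lebesgue_on_interval .
  have \<sigma>_int: "integrable (lebesgue_on {a..b}) (\<lambda>s. C * \<sigma> s)"
    using ab by (intro integrable_mult_right L1_integrable[OF \<sigma>]) auto
  have U_int: "integrable (lebesgue_on {a..b}) (\<lambda>s. U t s (h s))"
    using h ab by (rule integrable_U_apply)
  have "norm (integral\<^sup>L (lebesgue_on {a..b}) (\<lambda>s. U t s (h s))) \<le>
      integral\<^sup>L (lebesgue_on {a..b}) (\<lambda>s. norm (U t s (h s)))"
    by (rule integral_norm_bound)
  also have "\<dots> \<le> integral\<^sup>L (lebesgue_on {a..b}) (\<lambda>s. C * \<sigma> s)"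
    using integrable_norm[OF U_int] \<sigma>_int AE by (rule integral_mono_AE)
  finally show ?thesis by simp
qed

lemma norm_integral_U_apply_le_norm:
  assumes h: "h \<in> L1 T" and "0 \<le> a" "b \<le> t" "t \<le> T"
  shows "norm (integral\<^sup>L (lebesgue_on {a..b}) (\<lambda>s. U t s (h s))) \<le>
    C * integral\<^sup>L (lebesgue_on {a..b}) (\<lambda>s. norm (h s))"
  using h L1_norm[OF h] _ assms(2-4) by (rule norm_integral_U_apply_le) simp

text \<open>The evolution law \<open>U(t, s) = U(t, r) U(r, s)\<close> on the part of the integral before \<open>r\<close>.\<close>

lemma G_split:
  assumes h: "h \<in> L1 T" and "0 \<le> r" "r \<le> t" "t \<le> T"
  shows "G U h t = U t r (G U h r) + integral\<^sup>L (lebesgue_on {r..t}) (\<lambda>s. U t s (h s))"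
proof -
  have "G U h t = integral\<^sup>L (lebesgue_on {0..r}) (\<lambda>s. U t s (h s)) +
      integral\<^sup>L (lebesgue_on {r..t}) (\<lambda>s. U t s (h s))"
    unfolding G_def using assms by (intro integral_lebesgue_on_combine integrable_U_apply) auto
  also have "integral\<^sup>L (lebesgue_on {0..r}) (\<lambda>s. U t s (h s)) =
      integral\<^sup>L (lebesgue_on {0..r}) (\<lambda>s. U t r (U r s (h s)))"
    using assms by (intro Bochner_Integration.integral_cong) (auto simp: U_comp)
  also have "\<dots> = U t r (G U h r)"
    unfolding G_def using assms
    by (intro integral_bounded_linear blinfun.bounded_linear_right integrable_U_apply) auto
  finally show ?thesis .
qed

lemma G_diff:
  assumes "h \<in> L1 T" "k \<in> L1 T" "t \<le> T"
  shows "G U (\<lambda>s. h s - k s) t = G U h t - G U k t"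
  unfolding G_def blinfun.diff_right
  using assms by (intro Bochner_Integration.integral_diff integrable_U_apply) auto

lemma G_add:
  assumes "h \<in> L1 T" "k \<in> L1 T" "t \<le> T"
  shows "G U (\<lambda>s. h s + k s) t = G U h t + G U k t"
  unfolding G_def blinfun.add_right
  using assms by (intro Bochner_Integration.integral_add integrable_U_apply) auto

lemma G_scaleC:
  assumes "h \<in> L1 T" "t \<le> T"
  shows "G U (\<lambda>s. c *\<^sub>C h s) t = c *\<^sub>C G U h t"
proof -
  have "G U (\<lambda>s. c *\<^sub>C h s) t = integral\<^sup>L (lebesgue_on {0..t}) (\<lambda>s. c *\<^sub>C U t s (h s))"
    unfolding G_def using assms by (intro Bochner_Integration.integral_cong) (auto simp: U_scaleC)
  also have "\<dots> = c *\<^sub>C G U h t"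
    unfolding G_def using assms
    by (intro integral_bounded_linear bounded_linear_scaleC integrable_U_apply) auto
  finally show ?thesis .
qed

text \<open>Near \<open>t\<close>, the function \<open>G h\<close> is uniformly close to \<open>t' \<mapsto> U(t', r) (G h)(r)\<close> for a fixed \<open>r\<close> slightly
before \<open>t\<close>, and this function is continuous.\<close>

lemma continuous_on_G:
  assumes h: "h \<in> L1 T"
  shows "continuous_on {0..T} (G U h)"
  unfolding continuous_on_iff
proof (intro ballI allI impI)
  fix t e :: real assume t: "t \<in> {0..T}" and e: "e > 0"
  have C: "C \<ge> 0" using C_nonneg[of t] t by simp
  \<comment> \<open>Two remainders of size \<open>C * e'\<close> and one increment of the continuous function have to fit below \<open>e\<close>.\<close>
  define e' where "e' = e / (3 * (C + 1))"
  have e': "e' > 0" "C * e' < e / 3" using e C by (auto simp: e'_def field_simps)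
  obtain d where "d > 0" and d: "\<And>a b. 0 \<le> a \<Longrightarrow> a \<le> b \<Longrightarrow> b \<le> T \<Longrightarrow> b - a < d \<Longrightarrow>
      integral\<^sup>L (lebesgue_on {a..b}) (\<lambda>s. norm (h s)) < e'"
    using integral_small_on_short_intervals[OF _ e'(1)] L1_norm[OF h] unfolding L1_def by blast
  \<comment> \<open>At \<open>t = 0\<close> this is \<open>r = t = 0\<close>, and the argument covers that case as well.\<close>
  define r where "r = max 0 (t - d / 2)"
  have r: "0 \<le> r" "r \<le> t" "t - d / 2 \<le> r" using t \<open>d > 0\<close> by (auto simp: r_def)
  have near: "dist (G U h t') (U t' r (G U h r)) < e / 3" if "r \<le> t'" "t' \<le> T" "t' < t + d / 2" for t'
  proof -
    have "dist (G U h t') (U t' r (G U h r)) = norm (integral\<^sup>L (lebesgue_on {r..t'}) (\<lambda>s. U t' s (h s)))"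
      using G_split[OF h r(1) that(1,2)] by (simp add: dist_norm)
    also have "\<dots> \<le> C * integral\<^sup>L (lebesgue_on {r..t'}) (\<lambda>s. norm (h s))"
      using h r that by (intro norm_integral_U_apply_le_norm) auto
    also have "\<dots> \<le> C * e'"
      using d[of r t'] r that C by (intro mult_left_mono) auto
    finally show ?thesis using e'(2) by simp
  qed
  have "continuous_on {r..T} (\<lambda>t'. (\<lambda>(t, s). U t s (G U h r)) (t', r))"
    using r by (intro continuous_on_compose2[OF U_continuous] continuous_intros) auto
  then obtain d' where "d' > 0" and d': "\<And>t'. t' \<in> {r..T} \<Longrightarrow> dist t' t < d' \<Longrightarrow>
      dist (U t' r (G U h r)) (U t r (G U h r)) < e / 3"
    using r t e unfolding continuous_on_iff by (metis atLeastAtMost_iff case_prod_conv divide_pos_pos zero_less_numeral)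
  show "\<exists>d>0. \<forall>t'\<in>{0..T}. dist t' t < d \<longrightarrow> dist (G U h t') (G U h t) < e"
  proof (intro exI conjI ballI impI)
    show "min d' (d / 2) > 0" using \<open>d > 0\<close> \<open>d' > 0\<close> by simp
    fix t' assume t': "t' \<in> {0..T}" "dist t' t < min d' (d / 2)"
    then have "\<bar>t' - t\<bar> < d / 2" by (simp add: dist_real_def)
    then have "t - d / 2 \<le> t'" "t' < t + d / 2" by linarith+
    with t'(1) have "r \<le> t'" "t' < t + d / 2" by (auto simp: r_def)
    then have "dist (G U h t') (U t' r (G U h r)) < e / 3"
      "dist (U t' r (G U h r)) (U t r (G U h r)) < e / 3"
      "dist (G U h t) (U t r (G U h r)) < e / 3"
      using near d' t t' r \<open>d > 0\<close> by auto
    then show "dist (G U h t') (G U h t) < e"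
      using dist_triangle[of "G U h t'" "G U h t" "U t' r (G U h r)"]
        dist_triangle2[of "U t' r (G U h r)" "G U h t" "U t r (G U h r)"] by simp
  qed
qed

text \<open>The functional \<open>f\<close> composed with \<open>h \<mapsto> (G h)(t)\<close> belongs to the dual of \<open>L\<^sup>1\<close>.\<close>

lemma G_weakly_null:
  assumes weak: "\<And>\<phi>. \<phi> \<in> L1_dual T \<Longrightarrow> (\<lambda>n. \<phi> (u n)) \<longlonglongrightarrow> 0"
    and t: "0 \<le> t" "t \<le> T" and f: "f \<in> complex_dual"
  shows "(\<lambda>n. blinfun_apply f (G U (u n) t)) \<longlonglongrightarrow> 0"
proof (rule weak)
  have C: "C \<ge> 0" using C_nonneg[of t] t by simp
  have "norm (blinfun_apply f (G U h t)) \<le>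
      (norm f * C) * integral\<^sup>L (lebesgue_on {0..T}) (\<lambda>s. norm (h s))" if h: "h \<in> L1 T" for h
  proof -
    have "norm (blinfun_apply f (G U h t)) \<le> norm f * norm (G U h t)" by (rule norm_blinfun)
    also have "norm (G U h t) \<le> C * integral\<^sup>L (lebesgue_on {0..t}) (\<lambda>s. norm (h s))"
      unfolding G_def using h t by (intro norm_integral_U_apply_le_norm) auto
    also have "\<dots> \<le> C * integral\<^sup>L (lebesgue_on {0..T}) (\<lambda>s. norm (h s))"
      using integral_lebesgue_on_combine[of 0 T "\<lambda>s. norm (h s)" t] L1_norm[OF h] t C
      by (intro mult_left_mono) (auto simp: L1_def intro!: integral_nonneg)
    finally show ?thesis by (simp add: mult.assoc mult_left_mono)
  qed
  then show "(\<lambda>h. blinfun_apply f (G U h t)) \<in> L1_dual T"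
    using f t by (auto simp: L1_dual_def complex_dual_def G_add G_scaleC blinfun.add_right)
qed

text \<open>For \<open>r < t\<close> the compact operator \<open>U(t, r)\<close> improves the weak convergence at \<open>r\<close> to norm convergence;
the rest of the integral is small when \<open>r\<close> is close to \<open>t\<close>.\<close>

lemma G_pointwise_null:
  assumes u: "\<And>n. u n \<in> L1 T" and weak: "\<And>\<phi>. \<phi> \<in> L1_dual T \<Longrightarrow> (\<lambda>n. \<phi> (u n)) \<longlonglongrightarrow> 0"
    and \<sigma>: "\<sigma> \<in> L1 T" and bound: "\<And>n. AE s in lebesgue_on {0..T}. norm (u n s) \<le> \<sigma> s"
    and comp: "\<And>s t. 0 \<le> s \<Longrightarrow> s < t \<Longrightarrow> t \<le> T \<Longrightarrow> compact_operator (U t s)"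
    and t: "0 \<le> t" "t \<le> T"
  shows "(\<lambda>n. G U (u n) t) \<longlonglongrightarrow> 0"
proof (cases "t = 0")
  case True
  have "AE s in lebesgue_on {0..0}. U 0 s (u n s) = 0" for n
    unfolding AE_lebesgue_on_interval
    using AE_completion[OF AE_lborel_singleton[of "0::real"]] by eventually_elim simp
  then have "G U (u n) 0 = 0" for n unfolding G_def by (rule integral_eq_zero_AE)
  with True show ?thesis by simp
next
  case False
  with t have "t > 0" by simp
  have C: "C \<ge> 0" using C_nonneg[of t] t by simp
  show ?thesis
  proof (rule tendstoI)
    fix e :: real assume e: "e > 0"
    define e' where "e' = e / (2 * (C + 1))"
    have e': "e' > 0" "C * e' < e / 2" using e C by (auto simp: e'_def field_simps)
    obtain d where "d > 0" and d: "\<And>a b. 0 \<le> a \<Longrightarrow> a \<le> b \<Longrightarrow> b \<le> T \<Longrightarrow> b - a < d \<Longrightarrow>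
        integral\<^sup>L (lebesgue_on {a..b}) \<sigma> < e'"
      using integral_small_on_short_intervals[OF _ e'(1)] \<sigma> unfolding L1_def by blast
    define r where "r = max 0 (t - d / 2)"
    have r: "0 \<le> r" "r < t" "t - d / 2 \<le> r"
      using \<open>t > 0\<close> \<open>d > 0\<close> by (auto simp: r_def)
    have "(\<lambda>n. U t r (G U (u n) r)) \<longlonglongrightarrow> 0"
    proof (rule compact_operator_weakly_null[where K="U t r" and y="\<lambda>n. G U (u n) r"])
      show "compact_operator (U t r)" using comp r t by simp
      show "U t r (c *\<^sub>C x) = c *\<^sub>C U t r x" for c x
        by (rule U_scaleC) (use r t in auto)
      show "norm (G U (u n) r) \<le> C * integral\<^sup>L (lebesgue_on {0..r}) \<sigma>" for n
        unfolding G_def using r t by (intro norm_integral_U_apply_le u \<sigma> bound) auto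
      show "(\<lambda>n. blinfun_apply f (G U (u n) r)) \<longlonglongrightarrow> 0" if "f \<in> complex_dual" for f
        using r t by (intro G_weakly_null weak that) auto
    qed
    then have "\<forall>\<^sub>F n in sequentially. norm (U t r (G U (u n) r)) < e / 2"
      using e by (auto simp: tendsto_iff dest: spec[of _ "e / 2"])
    then show "\<forall>\<^sub>F n in sequentially. dist (G U (u n) t) 0 < e"
    proof eventually_elim
      case (elim n)
      have "norm (integral\<^sup>L (lebesgue_on {r..t}) (\<lambda>s. U t s (u n s))) \<le>
          C * integral\<^sup>L (lebesgue_on {r..t}) \<sigma>"
        using r t by (intro norm_integral_U_apply_le u \<sigma> bound) auto
      also have "\<dots> \<le> C * e'"
        using d[of r t] r t C \<open>d > 0\<close> by (intro mult_left_mono) auto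
      finally have "norm (integral\<^sup>L (lebesgue_on {r..t}) (\<lambda>s. U t s (u n s))) < e / 2"
        using e'(2) by simp
      with elim show ?case
        using G_split[OF u r(1), of t n] r t norm_triangle_lt[of "U t r (G U (u n) r)" _ e] by simp
    qed
  qed
qed

text \<open>Convergence on the finite grid \<open>d \<int> \<inter> [0, T]\<close> controls \<open>G u\<^sub>n\<close> between the grid points, since
\<open>(G u\<^sub>n)(t)\<close> and \<open>U(t, r) (G u\<^sub>n)(r)\<close> differ by less than \<open>e / 2\<close> for \<open>t - r < d\<close>.\<close>

lemma G_uniformly_null:
  assumes u: "\<And>n. u n \<in> L1 T" and weak: "\<And>\<phi>. \<phi> \<in> L1_dual T \<Longrightarrow> (\<lambda>n. \<phi> (u n)) \<longlonglongrightarrow> 0"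
    and \<sigma>: "\<sigma> \<in> L1 T" and bound: "\<And>n. AE s in lebesgue_on {0..T}. norm (u n s) \<le> \<sigma> s"
    and comp: "\<And>s t. 0 \<le> s \<Longrightarrow> s < t \<Longrightarrow> t \<le> T \<Longrightarrow> compact_operator (U t s)"
  shows "uniform_limit {0..T} (\<lambda>n. G U (u n)) (\<lambda>t. 0) sequentially"
proof (cases "T \<ge> 0")
  case True
  then have C: "C \<ge> 0" using C_nonneg[of T] by simp
  show ?thesis
  proof (rule uniform_limitI)
    fix e :: real assume e: "e > 0"
    define e' where "e' = e / (2 * (C + 1))"
    have e': "e' > 0" "C * e' < e / 2" using e C by (auto simp: e'_def field_simps)
    obtain d where "d > 0" and d: "\<And>a b. 0 \<le> a \<Longrightarrow> a \<le> b \<Longrightarrow> b \<le> T \<Longrightarrow> b - a < d \<Longrightarrow>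
        integral\<^sup>L (lebesgue_on {a..b}) \<sigma> < e'"
      using integral_small_on_short_intervals[OF _ e'(1)] \<sigma> unfolding L1_def by blast
    define P where "P = (\<lambda>i. of_int i * d) ` {0..\<lfloor>T / d\<rfloor>}"
    have "0 \<le> r \<and> r \<le> T" if "r \<in> P" for r
      using that \<open>d > 0\<close> by (auto simp: P_def le_floor_iff field_simps)
    then have "\<forall>r\<in>P. \<forall>\<^sub>F n in sequentially. norm (G U (u n) r) < e'"
      using G_pointwise_null[where u=u and \<sigma>=\<sigma>] u weak \<sigma> bound comp e'(1)
      by (auto simp: tendsto_iff)
    then have "\<forall>\<^sub>F n in sequentially. \<forall>r\<in>P. norm (G U (u n) r) < e'"
      by (intro eventually_ball_finite) (auto simp: P_def)
    then show "\<forall>\<^sub>F n in sequentially. \<forall>t\<in>{0..T}. dist (G U (u n) t) 0 < e"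
    proof eventually_elim
      case (elim n)
      show ?case
      proof
        fix t assume t: "t \<in> {0..T}"
        define r where "r = of_int \<lfloor>t / d\<rfloor> * d"
        have r: "0 \<le> r" "r \<le> t" "t - r < d"
          using t \<open>d > 0\<close> floor_divide_lower[of d t] floor_divide_upper[of d t]
          by (auto simp: r_def algebra_simps)
        have "r \<in> P"
          unfolding P_def r_def
          using t \<open>d > 0\<close> by (intro imageI) (simp add: floor_mono divide_right_mono)
        with elim have "norm (G U (u n) r) \<le> e'" by force
        then have "norm (U t r (G U (u n) r)) \<le> C * e'"
          using norm_U_apply[of r t "G U (u n) r"] r t C
          by (auto intro: order_trans mult_left_mono)
        moreover have "norm (integral\<^sup>L (lebesgue_on {r..t}) (\<lambda>s. U t s (u n s))) \<le>
            C * integral\<^sup>L (lebesgue_on {r..t}) \<sigma>"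
          using r t by (intro norm_integral_U_apply_le u \<sigma> bound) auto
        moreover have "\<dots> \<le> C * e'"
          using d[of r t] r t C by (intro mult_left_mono) auto
        ultimately show "dist (G U (u n) t) 0 < e"
          using G_split[OF u r(1,2), of n] t e'(2)
            norm_triangle_ineq[of "U t r (G U (u n) r)" "integral\<^sup>L (lebesgue_on {r..t}) (\<lambda>s. U t s (u n s))"]
          by simp
      qed
    qed
  qed
qed (simp add: uniform_limit_iff)

end

section \<open>Compactness of the generated evolution family\<close>

text \<open>Since \<open>U(t, s)\<close> has values in the domain of \<open>A(t)\<close> and \<open>A(t) U(t, s)\<close> is bounded,
\<open>U(t, s) = R(\<lambda>, A(t)) (\<lambda> U(t, s) - A(t) U(t, s))\<close> is a compact operator after a bounded one.\<close>

lemma generated_evolution_family_compact: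
  fixes A :: "real \<Rightarrow> 'a::complex_normed_vector \<Rightarrow> 'a"
  assumes R4: "cond_R4 T D A" and gen: "generates_evolution_family T D A U"
    and s: "0 \<le> s" "s < t" "t \<le> T"
  shows "compact_operator (U t s)"
proof -
  obtain l where l: "l \<in> resolvent_set (D t) (A t)"
    and comp: "compact_operator (resolvent l (D t) (A t))"
    using R4 s unfolding cond_R4_def by (meson atLeastAtMost_iff less_imp_le order_trans)
  have "bounded_linear (\<lambda>x. A t (U t s x))" and dom: "\<And>x. U t s x \<in> D t"
    using gen s unfolding generates_evolution_family_def opnorm_le_def by blast+
  then have W: "bounded_linear (\<lambda>x. l *\<^sub>C U t s x - A t (U t s x))"
    by (intro bounded_linear_sub bounded_linear_compose[OF bounded_linear_scaleC]
        blinfun.bounded_linear_right)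
  have R: "bounded_linear (resolvent l (D t) (A t))" using l by (simp add: resolvent_set_def)
  obtain M where "M > 0" and M: "\<And>x. norm (l *\<^sub>C U t s x - A t (U t s x)) \<le> norm x * M"
    using bounded_linear.pos_bounded[OF W] by blast
  have "U t s x = resolvent l (D t) (A t) (l *\<^sub>C U t s x - A t (U t s x))" for x
  proof -
    have "inj_on (\<lambda>x. l *\<^sub>C x - A t x) (D t)"
      using l by (simp add: resolvent_set_def bij_betw_def)
    from inv_into_f_f[OF this dom] show ?thesis by (simp add: resolvent_def)
  qed
  then have factor: "U t s x = M *\<^sub>R resolvent l (D t) (A t) ((1 / M) *\<^sub>R (l *\<^sub>C U t s x - A t (U t s x)))" for x
    using \<open>M > 0\<close> by (simp add: linear_cmul[OF bounded_linear.linear[OF R]])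
  have unit: "(1 / M) *\<^sub>R (l *\<^sub>C U t s x - A t (U t s x)) \<in> cball 0 1" if "x \<in> cball 0 1" for x
  proof -
    have "norm x * M \<le> M" using that \<open>M > 0\<close> by (simp add: mult_left_le_one_le)
    then have "norm (l *\<^sub>C U t s x - A t (U t s x)) \<le> M" by (rule order_trans[OF M])
    with \<open>M > 0\<close> show ?thesis by (simp add: divide_le_eq)
  qed
  have sub: "U t s ` cball 0 1 \<subseteq> (*\<^sub>R) M ` closure (resolvent l (D t) (A t) ` cball 0 1)"
  proof (rule image_subsetI)
    fix x :: 'a assume "x \<in> cball 0 1"
    from subsetD[OF closure_subset imageI[OF unit[OF this]]]
    show "U t s x \<in> (*\<^sub>R) M ` closure (resolvent l (D t) (A t) ` cball 0 1)"
      by (subst factor) (rule imageI)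
  qed
  have cpt: "compact ((*\<^sub>R) M ` closure (resolvent l (D t) (A t) ` cball 0 1))"
    using comp unfolding compact_operator_def by (blast intro: compact_scaling)
  have "closure (U t s ` cball 0 1) \<subseteq> (*\<^sub>R) M ` closure (resolvent l (D t) (A t) ` cball 0 1)"
    using sub compact_imp_closed[OF cpt] by (rule closure_minimal)
  then have "compact (closure (U t s ` cball 0 1))"
    using compact_Int_closed[OF cpt closed_closure[of "U t s ` cball 0 1"]]
    by (simp add: inf.absorb2)
  then show ?thesis
    unfolding compact_operator_def using blinfun.bounded_linear_right by blast
qed

section \<open>Convergence in the space of piecewise continuous functions\<close>

lemma L1_dual_diff:
  assumes \<phi>: "\<phi> \<in> L1_dual T" and "f \<in> L1 T" "g \<in> L1 T"
  shows "\<phi> (\<lambda>s. f s - g s) = \<phi> f - \<phi> g"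
proof -
  have minus: "(- 1) *\<^sub>C x = - x" for x :: 'a
    using scaleR_scaleC[of "- 1" x] by simp
  have add: "\<forall>f\<in>L1 T. \<forall>g\<in>L1 T. \<phi> (\<lambda>s. f s + g s) = \<phi> f + \<phi> g"
    and scale: "\<forall>c. \<forall>f\<in>L1 T. \<phi> (\<lambda>s. c *\<^sub>C f s) = c * \<phi> f"
    using \<phi> by (simp_all add: L1_dual_def)
  have "(\<lambda>s. - g s) \<in> L1 T" using assms by (simp add: L1_def)
  from add[rule_format, OF assms(2) this] scale[rule_format, OF assms(3), of "- 1"]
  show ?thesis by (simp add: minus)
qed

lemma continuous_on_imp_PC:
  fixes x :: "real \<Rightarrow> 'a::real_normed_vector"
  assumes x: "continuous_on {0..T} x" and P: "\<And>p. p \<in> P \<Longrightarrow> 0 < p \<and> p < T"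
  shows "x \<in> PC T P"
  unfolding PC_def
proof (intro CollectI conjI ballI)
  show "continuous_on ({0..T} - P) x" using x by (rule continuous_on_subset) auto
  fix p assume "p \<in> P"
  then have "isCont x p" using P[of p] x by (intro continuous_on_interior[of "{0..T}"]) auto
  then show "(x \<longlongrightarrow> x p) (at_left p)" "\<exists>l. (x \<longlongrightarrow> l) (at_right p)"
    unfolding continuous_at filterlim_at_split by auto
qed

lemma uniform_limit_zero_imp_PC_norm:
  fixes x :: "nat \<Rightarrow> real \<Rightarrow> 'a::real_normed_vector"
  assumes "0 \<le> T" and x: "uniform_limit {0..T} x (\<lambda>t. 0) sequentially"
  shows "(\<lambda>n. PC_norm T (x n)) \<longlonglongrightarrow> 0"
proof (rule tendstoI)
  fix e :: real assume "e > 0"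
  then have "\<forall>\<^sub>F n in sequentially. \<forall>t\<in>{0..T}. dist (x n t) 0 < e / 2"
    using x by (intro uniform_limitD) auto
  then show "\<forall>\<^sub>F n in sequentially. dist (PC_norm T (x n)) 0 < e"
  proof eventually_elim
    case (elim n)
    then have le: "norm (x n t) \<le> e / 2" if "t \<in> {0..T}" for t using that by force
    have "PC_norm T (x n) \<le> e / 2"
      unfolding PC_norm_def using \<open>0 \<le> T\<close> le by (intro cSUP_least) auto
    moreover have "norm (x n 0) \<le> PC_norm T (x n)"
      unfolding PC_norm_def using \<open>0 \<le> T\<close> le by (intro cSUP_upper bdd_aboveI2[where M="e / 2"]) auto
    ultimately show ?case
      using \<open>e > 0\<close> norm_ge_zero[of "x n 0"] by (simp add: dist_real_def del: norm_ge_zero)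
  qed
qed

theorem corollary3p7:
  fixes T :: real and m :: nat and \<tau> :: "nat \<Rightarrow> real"
    and D :: "real \<Rightarrow> 'a::{complex_normed_vector, banach, second_countable_topology} set"
    and A :: "real \<Rightarrow> 'a \<Rightarrow> 'a"
    and U :: "real \<Rightarrow> real \<Rightarrow> 'a \<Rightarrow>\<^sub>L 'a"
    and hs :: "nat \<Rightarrow> real \<Rightarrow> 'a" and h :: "real \<Rightarrow> 'a"
  assumes "reflexive_space TYPE('a)"
    and "strictly_convex_dual TYPE('a)"
    and "0 < T"
    and "strict_mono_on {1..m} \<tau>"
    and "\<And>k. k \<in> {1..m} \<Longrightarrow> 0 < \<tau> k \<and> \<tau> k < T"
    and "cond_R1 T D A"
    and "cond_R2 T D A"
    and "cond_R3 T D A"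
    and "cond_R4 T D A"
    and "generates_evolution_family T D A U"
    and "integrably_bounded T hs"
    and "weakly_converges_L1 T hs h"
  shows "(\<forall>n. G U (hs n) \<in> PC T (\<tau> ` {1..m})) \<and> G U h \<in> PC T (\<tau> ` {1..m}) \<and>
    (\<lambda>n. PC_norm T (\<lambda>t. G U (hs n) t - G U h t)) \<longlonglongrightarrow> 0"
proof -
  have "evolution_family T U \<and>
      (\<exists>C. \<forall>t s. 0 \<le> s \<and> s \<le> t \<and> t \<le> T \<longrightarrow> norm (U t s) \<le> C)"
    using \<open>generates_evolution_family T D A U\<close> unfolding generates_evolution_family_def
    by (elim conjE exE) (intro conjI exI, assumption+)
  then obtain C where "bounded_evolution_family T C U"
    by (auto simp: bounded_evolution_family_def)
  then interpret bounded_evolution_family T C U .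
  have hs: "\<And>n. hs n \<in> L1 T" and h: "h \<in> L1 T"
    and weak: "\<And>\<phi>. \<phi> \<in> L1_dual T \<Longrightarrow> (\<lambda>n. \<phi> (hs n)) \<longlonglongrightarrow> \<phi> h"
    using \<open>weakly_converges_L1 T hs h\<close> by (auto simp: weakly_converges_L1_def)
  obtain \<sigma> where \<sigma>: "\<sigma> \<in> L1 T" and bound: "\<And>n. AE s in lebesgue_on {0..T}. norm (hs n s) \<le> \<sigma> s"
    using \<open>integrably_bounded T hs\<close> by (auto simp: integrably_bounded_def)
  have "uniform_limit {0..T} (\<lambda>n. G U (\<lambda>s. hs n s - h s)) (\<lambda>t. 0) sequentially"
  proof (rule G_uniformly_null)
    show "(\<lambda>s. hs n s - h s) \<in> L1 T" for n using hs[of n] h by (simp add: L1_def)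
    show "(\<lambda>s. \<sigma> s + norm (h s)) \<in> L1 T" using \<sigma> h by (simp add: L1_def)
    show "AE s in lebesgue_on {0..T}. norm (hs n s - h s) \<le> \<sigma> s + norm (h s)" for n
      using bound[of n] by eventually_elim (rule order_trans[OF norm_triangle_ineq4], simp)
    show "(\<lambda>n. \<phi> (\<lambda>s. hs n s - h s)) \<longlonglongrightarrow> 0" if "\<phi> \<in> L1_dual T" for \<phi>
      using tendsto_diff[OF weak[OF that] tendsto_const[of "\<phi> h"]]
      by (simp add: L1_dual_diff[OF that hs h])
    show "compact_operator (U t s)" if "0 \<le> s" "s < t" "t \<le> T" for s t
      using \<open>cond_R4 T D A\<close> \<open>generates_evolution_family T D A U\<close> that
      by (rule generated_evolution_family_compact)
  qed
  then have "uniform_limit {0..T} (\<lambda>n t. G U (hs n) t - G U h t) (\<lambda>t. 0) sequentially"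
    by (simp add: uniform_limit_iff G_diff hs h)
  then show ?thesis
    using \<open>0 < T\<close> assms(5) hs h
    by (auto intro!: uniform_limit_zero_imp_PC_norm continuous_on_imp_PC continuous_on_G)
qed

end
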